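(* Let $\mathcal{P}$ be the set of all Pompeiu functions, i.e. of all differentiable functions $f:\mathbb{R}\to\mathbb{R}$ such that $f'$ vanishes on a dense subset of $\mathbb{R}$. Then the set of functions in $\mathcal{P}$ that are nonconstant on every non-degenerate interval of $\mathbb{R}$ is densely strongly $\mathfrak{c}$-algebrable in $\mathcal{C}(\mathbb{R})$.
   Context: $\mathfrak{c}$ denotes the cardinality of the continuum. $\mathcal{C}(\mathbb{R})$ is the algebra (with pointwise operations) of all continuous functions $\mathbb{R}\to\mathbb{R}$, endowed with the topology of uniform convergence on compact subsets of $\mathbb{R}$. A set $A\subset\mathcal{C}(\mathbb{R})$ is strongly $\mathfrak{c}$-algebrable if there is a free algebra $M\subset\mathcal{C}(\mathbb{R})$, freely generated by a set of $\mathfrak{c}$ generators, with $M\setminus\{0\}\subset A$. Equivalently, there is a set $B\subset\mathcal{C}(\mathbb{R})$ of cardinality $\mathfrak{c}$ such that for every $N\in\mathbb{N}$, every nonzero real polynomial $P$ in $N$ variables without constant term, and all distinct $f_1,\dots,f_N\in B$, one has $P(f_1,\dots,f_N)\neq 0$ and $P(f_1,\dots,f_N)\in A$; here $M$ is the (not necessarily unital) algebra generated by $B$, i.e. the set of all such $P(f_1,\dots,f_N)$ together with $0$. $A$ is densely strongly $\mathfrak{c}$-algebrable in $\mathcal{C}(\mathbb{R})$ if, in addition, $M$ can be chosen dense in $\mathcal{C}(\mathbb{R})$. *)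

theory Defs
  imports "HOL-Analysis.Analysis" "HOL-Library.Poly_Mapping" "HOL-Library.Equipollence"
begin

definition cont_funs :: "(real \<Rightarrow> real) set" where
  "cont_funs = {f. continuous_on UNIV f}"

text \<open>The topology of uniform convergence on compact sets on the continuous functions.\<close>

definition ucc_open :: "(real \<Rightarrow> real) set \<Rightarrow> bool" where
  "ucc_open U \<longleftrightarrow> U \<subseteq> cont_funs \<and>
     (\<forall>f\<in>U. \<exists>K e. compact K \<and> 0 < e \<and>
        {g \<in> cont_funs. \<forall>x\<in>K. \<bar>g x - f x\<bar> < e} \<subseteq> U)"

definition ucc_topology :: "(real \<Rightarrow> real) topology" where
  "ucc_topology = topology ucc_open"

lemma istopology_ucc_open: "istopology ucc_open"
  unfolding istopology_def
proof (intro conjI allI impI)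
  fix S T assume S: "ucc_open S" and T: "ucc_open T"
  show "ucc_open (S \<inter> T)"
    unfolding ucc_open_def
  proof (intro conjI ballI)
    show "S \<inter> T \<subseteq> cont_funs" using S by (auto simp: ucc_open_def)
  next
    fix f assume "f \<in> S \<inter> T"
    then obtain K e L d where
      K: "compact K" "0 < e" "{g \<in> cont_funs. \<forall>x\<in>K. \<bar>g x - f x\<bar> < e} \<subseteq> S" and
      L: "compact L" "0 < d" "{g \<in> cont_funs. \<forall>x\<in>L. \<bar>g x - f x\<bar> < d} \<subseteq> T"
      using S T unfolding ucc_open_def by (meson IntD1 IntD2)
    have "compact (K \<union> L)" "0 < min e d"
      using K L by auto
    moreover have "{g \<in> cont_funs. \<forall>x\<in>K \<union> L. \<bar>g x - f x\<bar> < min e d} \<subseteq> S \<inter> T"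
      using K(3) L(3) by auto
    ultimately show "\<exists>K e. compact K \<and> 0 < e \<and>
        {g \<in> cont_funs. \<forall>x\<in>K. \<bar>g x - f x\<bar> < e} \<subseteq> S \<inter> T"
      by blast
  qed
next
  fix \<U> assume U: "\<forall>S\<in>\<U>. ucc_open S"
  show "ucc_open (\<Union>\<U>)"
    unfolding ucc_open_def
  proof (intro conjI ballI)
    show "\<Union>\<U> \<subseteq> cont_funs" using U by (auto simp: ucc_open_def)
  next
    fix f assume "f \<in> \<Union>\<U>"
    then obtain S where S: "S \<in> \<U>" "f \<in> S" by blast
    then obtain K e where
      "compact K" "0 < e" "{g \<in> cont_funs. \<forall>x\<in>K. \<bar>g x - f x\<bar> < e} \<subseteq> S"
      using U unfolding ucc_open_def by meson
    with S(1) show "\<exists>K e. compact K \<and> 0 < e \<and>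
        {g \<in> cont_funs. \<forall>x\<in>K. \<bar>g x - f x\<bar> < e} \<subseteq> \<Union>\<U>"
      by blast
  qed
qed

lemma openin_ucc_topology: "openin ucc_topology U \<longleftrightarrow> ucc_open U"
  by (simp add: ucc_topology_def topology_inverse' istopology_ucc_open)

lemma topspace_ucc_topology: "topspace ucc_topology = cont_funs"
proof (rule antisym)
  show "topspace ucc_topology \<subseteq> cont_funs"
    by (auto simp: topspace_def openin_ucc_topology ucc_open_def)
  have "ucc_open cont_funs"
    unfolding ucc_open_def by (auto intro!: exI[of _ "{}"] exI[of _ 1])
  then show "cont_funs \<subseteq> topspace ucc_topology"
    by (simp add: openin_subset openin_ucc_topology)
qed

text \<open>Algebras are not required to be unital.\<close>

definition subalg :: "(real \<Rightarrow> real) set \<Rightarrow> bool" where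
  "subalg S \<longleftrightarrow> (\<lambda>_. 0) \<in> S \<and>
     (\<forall>f\<in>S. \<forall>g\<in>S. (\<lambda>x. f x + g x) \<in> S) \<and>
     (\<forall>c. \<forall>f\<in>S. (\<lambda>x. c * f x) \<in> S) \<and>
     (\<forall>f\<in>S. \<forall>g\<in>S. (\<lambda>x. f x * g x) \<in> S)"

text \<open>
  A real polynomial is a finitely supported map from monomials to coefficients, where a
  monomial is a finitely supported map from variables (numbered from 0) to exponents.
  In particular, the coefficient of the monomial 0 is the constant term.
\<close>

type_synonym real_mpoly = "(nat \<Rightarrow>\<^sub>0 nat) \<Rightarrow>\<^sub>0 real"

definition in_variables :: "nat \<Rightarrow> real_mpoly \<Rightarrow> bool" where
  "in_variables N P \<longleftrightarrow> (\<forall>m \<in> Poly_Mapping.keys P. Poly_Mapping.keys m \<subseteq> {..<N})"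

definition mpoly_apply :: "real_mpoly \<Rightarrow> (nat \<Rightarrow> real \<Rightarrow> real) \<Rightarrow> real \<Rightarrow> real" where
  "mpoly_apply P f = (\<lambda>x. \<Sum>m \<in> Poly_Mapping.keys P.
     Poly_Mapping.lookup P m * (\<Prod>i \<in> Poly_Mapping.keys m. f i x ^ Poly_Mapping.lookup m i))"

definition freely_generates :: "(real \<Rightarrow> real) set \<Rightarrow> (real \<Rightarrow> real) set \<Rightarrow> bool" where
  "freely_generates B M \<longleftrightarrow> M = subalg hull B \<and>
     (\<forall>N P f. in_variables N P \<and> P \<noteq> 0 \<and> Poly_Mapping.lookup P 0 = 0 \<and>
        inj_on f {..<N} \<and> f ` {..<N} \<subseteq> B \<longrightarrow> mpoly_apply P f \<noteq> (\<lambda>_. 0))"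

definition densely_strongly_continuum_algebrable :: "(real \<Rightarrow> real) set \<Rightarrow> bool" where
  "densely_strongly_continuum_algebrable A \<longleftrightarrow> A \<subseteq> cont_funs \<and>
     (\<exists>B M. B \<subseteq> cont_funs \<and> B \<approx> (UNIV :: real set) \<and> freely_generates B M \<and>
        M - {\<lambda>_. 0} \<subseteq> A \<and> ucc_topology closure_of M = topspace ucc_topology)"

definition pompeiu_functions :: "(real \<Rightarrow> real) set" where
  "pompeiu_functions =
     {f. (\<forall>x. f differentiable (at x)) \<and> closure {x. deriv f x = 0} = UNIV}"

definition nowhere_constant :: "(real \<Rightarrow> real) \<Rightarrow> bool" where
  "nowhere_constant f \<longleftrightarrow>
     (\<forall>I. is_interval I \<and> (\<exists>a\<in>I. \<exists>b\<in>I. a < b) \<longrightarrow> \<not> f constant_on I)"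

end

theory Submission
  imports Defs "HOL-Complex_Analysis.Conformal_Mappings"
begin

text \<open>
  Following Pompeiu, let \<open>\<phi>\<close> be the inverse of \<open>g x = (\<Sum>j. a j * root 3 (x - q j))\<close>, where \<open>q\<close>
  enumerates the rationals and the positive weights \<open>a j\<close> decay fast. The difference quotients of
  \<open>g\<close> have a positive, possibly infinite limit everywhere, and the limit is infinite at the points
  \<open>q j\<close>. Hence \<open>\<phi>\<close> is strictly increasing and differentiable, and its derivative vanishes
  on the dense set of the \<open>g (q j)\<close>.

  By the chain rule \<open>H \<circ> \<phi>\<close> is a Pompeiu function for every differentiable \<open>H\<close>. The generators are
  \<open>exp (exp (t * \<phi> x))\<close> for \<open>t > 0\<close>. A polynomial in them without constant term is \<open>H \<circ> \<phi>\<close>, where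
  \<open>H\<close> is a linear combination of exponentials of nonzero sums \<open>m\<^sub>1 * exp (t\<^sub>1 * x) + \<dots>\<close> with natural
  coefficients. Any two such sums grow at different rates at infinity, so one summand of \<open>H\<close>
  dominates and is unbounded: a nontrivial \<open>H\<close> is not constant on the line. As \<open>H\<close> extends to an
  entire function, it is then not constant on any interval. This gives both freeness and nowhere
  constancy. A single generator already generates a dense algebra, by the theorem of Weierstrass,
  because it is injective and has no zeros.
\<close>

section \<open>A strictly increasing Pompeiu function\<close>

lemma abs_root3_le: "\<bar>root 3 y\<bar> \<le> 1 + \<bar>y\<bar>"
proof (cases "\<bar>root 3 y\<bar> \<le> 1")
  case False
  then have "\<bar>root 3 y\<bar> ^ 1 \<le> \<bar>root 3 y\<bar> ^ 3"
    by (intro power_increasing) auto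
  also have "\<bar>root 3 y\<bar> ^ 3 = \<bar>y\<bar>"
    by (simp add: power_abs [symmetric] odd_real_root_pow)
  finally show ?thesis by simp
qed auto

definition root3_slope :: "real \<Rightarrow> real \<Rightarrow> real" where
  "root3_slope x z = (root 3 z - root 3 x) / (z - x)"

text \<open>Factor \<open>z - x\<close> as a difference of cubes of the two roots and cancel their
  difference.\<close>

lemma root3_slope_eq:
  assumes "z \<noteq> x"
  shows "root3_slope x z = 1 / ((root 3 z)\<^sup>2 + root 3 z * root 3 x + (root 3 x)\<^sup>2)"
proof -
  let ?u = "root 3 z" and ?v = "root 3 x"
  have "z - x = ?u ^ 3 - ?v ^ 3"
    by (simp add: odd_real_root_pow)
  also have "\<dots> = (?u - ?v) * (?u\<^sup>2 + ?u * ?v + ?v\<^sup>2)"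
    by (simp add: power2_eq_square power3_eq_cube algebra_simps)
  finally have "z - x = (?u - ?v) * (?u\<^sup>2 + ?u * ?v + ?v\<^sup>2)" .
  moreover have "?u - ?v \<noteq> 0"
    using assms by simp
  ultimately show ?thesis
    unfolding root3_slope_def by simp
qed

lemma root3_slope_nonneg: "0 \<le> root3_slope x z"
  unfolding root3_slope_def
  by (cases "x \<le> z") (auto intro!: divide_nonneg_nonneg divide_nonpos_nonpos)

text \<open>Completing the square bounds the denominator from below. The bound is independent of
  \<open>z\<close> and is four times the derivative at \<open>x\<close>, so a convergent series of
  derivatives yields a majorant.\<close>

lemma root3_slope_le:
  assumes "z \<noteq> x" "x \<noteq> 0"
  shows "root3_slope x z \<le> 4 / 3 / (root 3 x)\<^sup>2"
proof -
  let ?u = "root 3 z" and ?v = "root 3 x"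
  have "?u\<^sup>2 + ?u * ?v + ?v\<^sup>2 = (?u + ?v / 2)\<^sup>2 + 3 / 4 * ?v\<^sup>2"
    by (simp add: power2_eq_square algebra_simps)
  then have le: "3 / 4 * ?v\<^sup>2 \<le> ?u\<^sup>2 + ?u * ?v + ?v\<^sup>2"
    by simp
  have "0 < 3 / 4 * ?v\<^sup>2"
    using assms by simp
  then have "root3_slope x z \<le> 1 / (3 / 4 * ?v\<^sup>2)"
    unfolding root3_slope_eq[OF assms(1)] using le
    by (intro divide_left_mono mult_pos_pos) linarith+
  then show ?thesis by simp
qed

lemma root3_slope_tendsto:
  assumes "x \<noteq> 0"
  shows "(root3_slope x \<longlongrightarrow> 1 / (3 * (root 3 x)\<^sup>2)) (at x)"
proof (rule Lim_transform_eventually)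
  show "((\<lambda>z. 1 / ((root 3 z)\<^sup>2 + root 3 z * root 3 x + (root 3 x)\<^sup>2)) \<longlongrightarrow>
      1 / (3 * (root 3 x)\<^sup>2)) (at x)"
    using assms by (auto intro!: tendsto_eq_intros simp: power2_eq_square)
  show "\<forall>\<^sub>F z in at x. 1 / ((root 3 z)\<^sup>2 + root 3 z * root 3 x + (root 3 x)\<^sup>2) = root3_slope x z"
    using root3_slope_eq by (auto simp: eventually_at_filter)
qed

lemma root3_slope_0_at_top: "LIM z at 0. root3_slope 0 z :> at_top"
proof -
  have "LIM z at 0. inverse ((root 3 z)\<^sup>2) :> at_top"
  proof (rule filterlim_inverse_at_top)
    show "((\<lambda>z. (root 3 z)\<^sup>2) \<longlongrightarrow> 0) (at 0)"
      by (auto intro!: tendsto_eq_intros)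
  qed (auto simp: eventually_at_filter)
  moreover have "\<forall>\<^sub>F z in at 0. inverse ((root 3 z)\<^sup>2) = root3_slope 0 z"
    using root3_slope_eq[of _ 0] by (auto simp: eventually_at_filter inverse_eq_divide)
  ultimately show ?thesis
    by (simp cong: filterlim_cong)
qed

section \<open>The weighted series of shifted cube roots\<close>

definition root3_series :: "(nat \<Rightarrow> real) \<Rightarrow> (nat \<Rightarrow> real) \<Rightarrow> real \<Rightarrow> real" where
  "root3_series a q x = suminf (\<lambda>j. a j * root 3 (x - q j))"

context
  fixes a q :: "nat \<Rightarrow> real"
  assumes a_pos: "\<And>j. 0 < a j"
    and summable_aq: "summable (\<lambda>j. a j * (1 + \<bar>q j\<bar>))"
begin

text \<open>The bound splits into a factor in \<open>j\<close> and a factor in \<open>x\<close>, so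
  the summability assumption dominates the series uniformly on bounded sets.\<close>

lemma root3_series_term_le: "\<bar>a j * root 3 (x - q j)\<bar> \<le> a j * (1 + \<bar>q j\<bar>) * (1 + \<bar>x\<bar>)"
proof -
  have "\<bar>root 3 (x - q j)\<bar> \<le> 1 + \<bar>x - q j\<bar>"
    by (rule abs_root3_le)
  also have "\<dots> \<le> 1 + (\<bar>x\<bar> + \<bar>q j\<bar>) + \<bar>q j\<bar> * \<bar>x\<bar>"
    using abs_triangle_ineq4[of x "q j"] mult_nonneg_nonneg[of "\<bar>q j\<bar>" "\<bar>x\<bar>"] by linarith
  also have "\<dots> = (1 + \<bar>q j\<bar>) * (1 + \<bar>x\<bar>)"
    by (simp add: algebra_simps)
  finally show ?thesis
    using a_pos[of j] by (simp add: abs_mult mult.assoc)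
qed

lemma summable_root3_series: "summable (\<lambda>j. a j * root 3 (x - q j))"
proof (rule summable_comparison_test')
  show "summable (\<lambda>j. a j * (1 + \<bar>q j\<bar>) * (1 + \<bar>x\<bar>))"
    by (intro summable_mult2 summable_aq)
qed (use root3_series_term_le in auto)

text \<open>Tannery's theorem (dominated convergence for series), with a majorant valid for all
  \<open>z\<close> within distance 1 of \<open>x\<close>.\<close>

lemma isCont_root3_series: "isCont (root3_series a q) x"
proof -
  have ev: "\<forall>\<^sub>F z in at x. \<bar>z\<bar> \<le> 1 + \<bar>x\<bar>"
    unfolding eventually_at by (rule exI[of _ 1]) (auto simp: dist_real_def)
  have le: "norm (a j * root 3 (z - q j)) \<le> a j * (1 + \<bar>q j\<bar>) * (2 + \<bar>x\<bar>)"
    if "\<bar>z\<bar> \<le> 1 + \<bar>x\<bar>" for j z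
  proof -
    have "a j * (1 + \<bar>q j\<bar>) * (1 + \<bar>z\<bar>) \<le> a j * (1 + \<bar>q j\<bar>) * (2 + \<bar>x\<bar>)"
      using that a_pos[of j] by (intro mult_left_mono) auto
    then show ?thesis
      using root3_series_term_le[of j z] by simp
  qed
  have "((\<lambda>z. suminf (\<lambda>j. a j * root 3 (z - q j))) \<longlongrightarrow>
      suminf (\<lambda>j. a j * root 3 (x - q j))) (at x)"
  proof (rule tannerys_theorem[THEN conjunct2, THEN conjunct2])
    show "((\<lambda>z. a j * root 3 (z - q j)) \<longlongrightarrow> a j * root 3 (x - q j)) (at x)" for j
      by (auto intro!: tendsto_intros)
    show "\<forall>\<^sub>F (j, z) in at_top \<times>\<^sub>F at x.
        norm (a j * root 3 (z - q j)) \<le> a j * (1 + \<bar>q j\<bar>) * (2 + \<bar>x\<bar>)"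
      unfolding eventually_prod_filter
      by (rule exI[of _ "\<lambda>_. True"], rule exI[of _ "\<lambda>z. \<bar>z\<bar> \<le> 1 + \<bar>x\<bar>"]) (use ev le in auto)
    show "summable (\<lambda>j. a j * (1 + \<bar>q j\<bar>) * (2 + \<bar>x\<bar>))"
      by (intro summable_mult2 summable_aq)
  qed auto
  then show ?thesis
    unfolding isCont_def root3_series_def[abs_def] .
qed

lemma root3_series_diff:
  "root3_series a q z - root3_series a q x = suminf (\<lambda>j. a j * (root 3 (z - q j) - root 3 (x - q j)))"
  by (simp add: root3_series_def suminf_diff summable_root3_series right_diff_distrib)

lemma strict_mono_root3_series: "strict_mono (root3_series a q)"
proof (rule strict_monoI)
  fix x y :: real assume "x < y"
  have "0 < suminf (\<lambda>j. a j * (root 3 (y - q j) - root 3 (x - q j)))"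
  proof (rule suminf_pos)
    show "summable (\<lambda>j. a j * (root 3 (y - q j) - root 3 (x - q j)))"
      unfolding right_diff_distrib by (intro summable_diff summable_root3_series)
  qed (use a_pos \<open>x < y\<close> in simp)
  then show "root3_series a q x < root3_series a q y"
    unfolding root3_series_diff[symmetric] by simp
qed

text \<open>Every term of the difference series is nonnegative, so each one bounds the sum from
  below.\<close>

lemma root3_series_diff_ge:
  assumes "x \<le> z"
  shows "a j * (root 3 (z - q j) - root 3 (x - q j)) \<le> root3_series a q z - root3_series a q x"
proof -
  have "(\<Sum>i\<in>{j}. a i * (root 3 (z - q i) - root 3 (x - q i)))
      \<le> suminf (\<lambda>i. a i * (root 3 (z - q i) - root 3 (x - q i)))"
  proof (rule sum_le_suminf)
    show "summable (\<lambda>i. a i * (root 3 (z - q i) - root 3 (x - q i)))"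
      unfolding right_diff_distrib by (intro summable_diff summable_root3_series)
    show "0 \<le> a i * (root 3 (z - q i) - root 3 (x - q i))" for i
      using less_imp_le[OF a_pos] assms by (intro mult_nonneg_nonneg) auto
  qed simp
  then show ?thesis
    by (simp add: root3_series_diff)
qed

lemma surj_root3_series: "surj (root3_series a q)"
proof -
  let ?g = "root3_series a q"
  have "\<exists>x. ?g x = y" for y
  proof -
    \<comment> \<open>Moving by \<open>t ^ 3\<close> to either side of \<open>q 0\<close> changes
      the summand with index 0 by exactly \<open>a 0 * t\<close>, the distance from
      \<open>?g (q 0)\<close> to \<open>y\<close>; this traps \<open>y\<close> between two
      values.\<close>
    define t where "t = \<bar>y - ?g (q 0)\<bar> / a 0"
    have t: "0 \<le> t" "\<bar>y - ?g (q 0)\<bar> = a 0 * t"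
      using a_pos[of 0] by (auto simp: t_def)
    have r: "root 3 (t ^ 3) = t" "root 3 (- (t ^ 3)) = - t"
      using t(1) by (simp_all add: real_root_minus real_root_power_cancel)
    have "a 0 * t \<le> ?g (q 0 + t ^ 3) - ?g (q 0)"
      using root3_series_diff_ge[of "q 0" "q 0 + t ^ 3" 0] t(1) r by simp
    moreover have "a 0 * t \<le> ?g (q 0) - ?g (q 0 - t ^ 3)"
      using root3_series_diff_ge[of "q 0 - t ^ 3" "q 0" 0] t(1) r by simp
    ultimately have "?g (q 0 - t ^ 3) \<le> y" "y \<le> ?g (q 0 + t ^ 3)"
      using t(2) by linarith+
    then show ?thesis
      using IVT[of ?g "q 0 - t ^ 3" y "q 0 + t ^ 3"] isCont_root3_series t(1) by auto
  qed
  then show ?thesis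
    by (metis surj_def)
qed

section \<open>Limits of the difference quotients of the series\<close>

lemma root3_series_slope:
  assumes "z \<noteq> x"
  shows "summable (\<lambda>j. a j * root3_slope (x - q j) (z - q j))"
    and "(root3_series a q z - root3_series a q x) / (z - x)
      = suminf (\<lambda>j. a j * root3_slope (x - q j) (z - q j))"
proof -
  have *: "a j * root3_slope (x - q j) (z - q j) =
      a j * (root 3 (z - q j) - root 3 (x - q j)) / (z - x)" for j
    by (simp add: root3_slope_def)
  have s: "summable (\<lambda>j. a j * (root 3 (z - q j) - root 3 (x - q j)))"
    unfolding right_diff_distrib by (intro summable_diff summable_root3_series)
  then show "summable (\<lambda>j. a j * root3_slope (x - q j) (z - q j))"
    unfolding * by (rule summable_divide)
  show "(root3_series a q z - root3_series a q x) / (z - x)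
      = suminf (\<lambda>j. a j * root3_slope (x - q j) (z - q j))"
    unfolding * root3_series_diff by (rule suminf_divide[OF s, symmetric])
qed

text \<open>Slopes are nonnegative, so finite partial sums are lower bounds. Both proofs of an
  infinite limit rest on this.\<close>

lemma sum_le_root3_series_slope:
  assumes "z \<noteq> x" "finite I"
  shows "(\<Sum>j\<in>I. a j * root3_slope (x - q j) (z - q j))
    \<le> (root3_series a q z - root3_series a q x) / (z - x)"
  unfolding root3_series_slope(2)[OF assms(1)]
  by (intro sum_le_suminf root3_series_slope(1) assms mult_nonneg_nonneg root3_slope_nonneg
      less_imp_le[OF a_pos])

lemma root3_slope_shift_tendsto:
  assumes "x \<noteq> q j"
  shows "((\<lambda>z. a j * root3_slope (x - q j) (z - q j)) \<longlongrightarrow> a j * (1 / (3 * (root 3 (x - q j))\<^sup>2))) (at x)"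
proof -
  have "filterlim (\<lambda>z. z - q j) (at (x - q j)) (at x)"
    by (auto simp: filterlim_at eventually_at_filter intro!: tendsto_intros)
  with root3_slope_tendsto[of "x - q j"] assms show ?thesis
    by (intro tendsto_mult tendsto_const) (auto elim: filterlim_compose)
qed

text \<open>The summand with index \<open>j\<close> alone forces the limit, as the cube root has a
  vertical tangent at 0.\<close>

lemma root3_series_slope_at_top_node:
  "LIM z at (q j). (root3_series a q z - root3_series a q (q j)) / (z - q j) :> at_top"
proof (rule filterlim_at_top_mono)
  have "filterlim (\<lambda>z. z - q j) (at 0) (at (q j))"
    by (auto simp: filterlim_at eventually_at_filter intro!: tendsto_eq_intros)
  then have "LIM z at (q j). root3_slope 0 (z - q j) :> at_top"
    by (rule filterlim_compose[OF root3_slope_0_at_top])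
  then show "LIM z at (q j). a j * root3_slope 0 (z - q j) :> at_top"
    by (rule filterlim_tendsto_pos_mult_at_top[OF tendsto_const a_pos])
  show "\<forall>\<^sub>F z in at (q j). a j * root3_slope 0 (z - q j)
      \<le> (root3_series a q z - root3_series a q (q j)) / (z - q j)"
    using sum_le_root3_series_slope[of _ "q j" "{j}"] by (auto simp: eventually_at_filter)
qed

text \<open>If the termwise derivatives have a divergent sum, some partial sum exceeds
  \<open>C\<close>; the corresponding finite sum of slopes converges to it and bounds the quotient
  from below.\<close>

lemma root3_series_slope_at_top:
  assumes "x \<notin> range q" "\<not> summable (\<lambda>j. a j * (1 / (3 * (root 3 (x - q j))\<^sup>2)))"
  shows "LIM z at x. (root3_series a q z - root3_series a q x) / (z - x) :> at_top"
  unfolding filterlim_at_top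
proof
  fix C :: real
  let ?b = "\<lambda>j. a j * (1 / (3 * (root 3 (x - q j))\<^sup>2))"
  have "0 \<le> ?b j" for j
    by (intro mult_nonneg_nonneg less_imp_le[OF a_pos]) simp
  then have "\<exists>N. \<not> (\<Sum>j<N. ?b j) \<le> C"
    using assms(2) summableI_nonneg_bounded[of ?b C] by blast
  then obtain N where N: "C < (\<Sum>j<N. ?b j)"
    unfolding not_le by blast
  have "((\<lambda>z. \<Sum>j<N. a j * root3_slope (x - q j) (z - q j)) \<longlongrightarrow> (\<Sum>j<N. ?b j)) (at x)"
    using assms(1) by (intro tendsto_sum root3_slope_shift_tendsto) auto
  then have "\<forall>\<^sub>F z in at x. C < (\<Sum>j<N. a j * root3_slope (x - q j) (z - q j))"
    using N by (rule order_tendstoD)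
  moreover have "\<forall>\<^sub>F z in at x. z \<noteq> x"
    by (simp add: eventually_at_filter)
  ultimately show "\<forall>\<^sub>F z in at x. C \<le> (root3_series a q z - root3_series a q x) / (z - x)"
  proof eventually_elim
    case (elim z)
    then show ?case
      using sum_le_root3_series_slope[of z x "{..<N}"] by simp
  qed
qed

text \<open>Tannery's theorem again, with four times the termwise derivative as majorant.\<close>

lemma root3_series_slope_tendsto:
  assumes "x \<notin> range q" "summable (\<lambda>j. a j * (1 / (3 * (root 3 (x - q j))\<^sup>2)))"
  shows "((\<lambda>z. (root3_series a q z - root3_series a q x) / (z - x)) \<longlongrightarrow>
    suminf (\<lambda>j. a j * (1 / (3 * (root 3 (x - q j))\<^sup>2)))) (at x)"
proof (rule Lim_transform_eventually)
  show "\<forall>\<^sub>F z in at x. suminf (\<lambda>j. a j * root3_slope (x - q j) (z - q j))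
      = (root3_series a q z - root3_series a q x) / (z - x)"
    using root3_series_slope(2)[of _ x] by (auto simp: eventually_at_filter)
  show "((\<lambda>z. suminf (\<lambda>j. a j * root3_slope (x - q j) (z - q j))) \<longlongrightarrow>
      suminf (\<lambda>j. a j * (1 / (3 * (root 3 (x - q j))\<^sup>2)))) (at x)"
  proof (rule tannerys_theorem[THEN conjunct2, THEN conjunct2])
    let ?M = "\<lambda>j. 4 * (a j * (1 / (3 * (root 3 (x - q j))\<^sup>2)))"
    show "((\<lambda>z. a j * root3_slope (x - q j) (z - q j)) \<longlongrightarrow>
        a j * (1 / (3 * (root 3 (x - q j))\<^sup>2))) (at x)" for j
      using assms(1) by (intro root3_slope_shift_tendsto) auto
    have le: "norm (a j * root3_slope (x - q j) (z - q j)) \<le> ?M j" if "z \<noteq> x" for j z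
    proof -
      have "a j * root3_slope (x - q j) (z - q j) \<le> a j * (4 / 3 / (root 3 (x - q j))\<^sup>2)"
        using that assms(1) by (intro mult_left_mono root3_slope_le less_imp_le[OF a_pos]) auto
      then show ?thesis
        using root3_slope_nonneg a_pos[of j] by (simp add: abs_mult)
    qed
    show "\<forall>\<^sub>F (j, z) in at_top \<times>\<^sub>F at x. norm (a j * root3_slope (x - q j) (z - q j)) \<le> ?M j"
      unfolding eventually_prod_filter
      by (rule exI[of _ "\<lambda>_. True"], rule exI[of _ "\<lambda>z. z \<noteq> x"])
         (use le in \<open>auto simp: eventually_at_filter\<close>)
    show "summable ?M"
      by (intro summable_mult assms(2))
  qed auto
qed

text \<open>The slope tends to a positive number or to infinity, so its reciprocal always converges,
  with limit 0 in the infinite case. The reciprocal is the difference quotient of the inverse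
  function.\<close>

lemma root3_series_inverse_slope:
  obtains l where "((\<lambda>z. (z - x) / (root3_series a q z - root3_series a q x)) \<longlongrightarrow> l) (at x)"
    and "x \<in> range q \<Longrightarrow> l = 0"
proof -
  let ?s = "\<lambda>z. (root3_series a q z - root3_series a q x) / (z - x)"
  let ?b = "\<lambda>j. a j * (1 / (3 * (root 3 (x - q j))\<^sup>2))"
  have inv: "inverse (?s z) = (z - x) / (root3_series a q z - root3_series a q x)" for z
    by simp
  show thesis
  proof (cases "x \<in> range q \<or> \<not> summable ?b")
    case True
    then have "LIM z at x. ?s z :> at_top"
      using root3_series_slope_at_top_node root3_series_slope_at_top
      by (cases "x \<in> range q") auto
    then have "((\<lambda>z. inverse (?s z)) \<longlongrightarrow> 0) (at x)"
      by (intro tendsto_inverse_0_at_top)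
    then show thesis
      unfolding inv by (rule that) simp
  next
    case False
    then have b: "x \<notin> range q" "summable ?b"
      by auto
    have "0 < ?b j" for j
      using b(1) by (intro mult_pos_pos a_pos) auto
    then have "0 < suminf ?b"
      by (rule suminf_pos[OF b(2)])
    then have "((\<lambda>z. inverse (?s z)) \<longlongrightarrow> inverse (suminf ?b)) (at x)"
      by (intro tendsto_inverse root3_series_slope_tendsto b) simp
    then show thesis
      unfolding inv by (rule that) (use b(1) in simp)
  qed
qed

end

section \<open>The inverse of the series as a Pompeiu function\<close>

theorem ex_strict_mono_pompeiu:
  obtains \<phi> :: "real \<Rightarrow> real" where "strict_mono \<phi>" "\<phi> \<in> pompeiu_functions"
proof -
  define q :: "nat \<Rightarrow> real" where "q = from_nat_into \<rat>"
  \<comment> \<open>The denominator cancels the factor \<open>1 + \<bar>q j\<bar>\<close> of the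
    summability assumption, leaving a geometric series.\<close>
  define a :: "nat \<Rightarrow> real" where "a = (\<lambda>j. (1 / 2) ^ j / (1 + \<bar>q j\<bar>))"
  have "\<rat> \<noteq> ({} :: real set)"
    using Rats_0 by blast
  then have q: "range q = \<rat>"
    unfolding q_def by (rule range_from_nat_into) (rule countable_rat)
  have a: "0 < a j" for j
    unfolding a_def by (intro divide_pos_pos add_pos_nonneg) simp_all
  have "a j * (1 + \<bar>q j\<bar>) = (1 / 2) ^ j" for j
    using abs_ge_zero[of "q j"] by (simp add: a_def add_nonneg_eq_0_iff)
  then have s: "summable (\<lambda>j. a j * (1 + \<bar>q j\<bar>))"
    by (simp add: summable_geometric)
  let ?g = "root3_series a q"
  define \<phi> where "\<phi> = inv ?g"
  note mono = strict_mono_root3_series[OF a s] and cont = isCont_root3_series[OF a s]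
  note surj = surj_root3_series[OF a s]
  have \<phi>g: "\<phi> (?g x) = x" for x
    unfolding \<phi>_def using strict_mono_imp_inj_on[OF mono] by simp
  have g\<phi>: "?g (\<phi> y) = y" for y
    unfolding \<phi>_def using surj by (rule surj_f_inv_f)
  have "strict_mono \<phi>"
    using mono surj \<phi>g by (rule strict_mono_inv)
  have \<phi>_cont: "isCont \<phi> y" for y
    using isCont_inverse_function[of 1 "\<phi> y" \<phi> ?g] \<phi>g cont g\<phi> by simp
  have deriv: "\<exists>l. (\<phi> has_real_derivative l) (at y) \<and> (\<phi> y \<in> \<rat> \<longrightarrow> l = 0)" for y
  proof -
    obtain l where l: "((\<lambda>z. (z - \<phi> y) / (?g z - ?g (\<phi> y))) \<longlongrightarrow> l) (at (\<phi> y))"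
      and l0: "\<phi> y \<in> range q \<Longrightarrow> l = 0"
      using root3_series_inverse_slope[OF a s] by blast
    \<comment> \<open>Substituting \<open>\<phi> z\<close> into the reciprocal slope requires
      \<open>\<phi> z\<close> to differ from \<open>\<phi> y\<close> for \<open>z\<close> near but
      distinct from \<open>y\<close>, which strict monotonicity gives.\<close>
    have "filterlim \<phi> (at (\<phi> y)) (at y)"
      using \<phi>_cont[of y] \<open>strict_mono \<phi>\<close>
      by (auto simp: filterlim_at isCont_def eventually_at_filter strict_mono_eq)
    from filterlim_compose[OF l this] have "((\<lambda>z. (\<phi> z - \<phi> y) / (z - y)) \<longlongrightarrow> l) (at y)"
      by (simp add: g\<phi>)
    then show ?thesis
      using l0 q by (auto simp: has_field_derivative_iff)
  qed
  have "?g ` \<rat> \<subseteq> {y. deriv \<phi> y = 0}"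
  proof clarsimp
    fix x :: real assume "x \<in> \<rat>"
    then show "deriv \<phi> (?g x) = 0"
      using deriv[of "?g x"] \<phi>g DERIV_imp_deriv by auto
  qed
  \<comment> \<open>A continuous surjection maps the dense set of rationals onto a dense
    set.\<close>
  moreover have "?g ` closure \<rat> \<subseteq> closure (?g ` \<rat>)"
    by (rule continuous_image_closure_subset[of UNIV])
       (use cont in \<open>auto intro: continuous_at_imp_continuous_on\<close>)
  moreover have "?g ` closure \<rat> = UNIV"
    using surj by (simp add: Rats_closure_real)
  ultimately have "closure {y. deriv \<phi> y = 0} = UNIV"
    using closure_mono[of "?g ` \<rat>" "{y. deriv \<phi> y = 0}"]
    by (metis UNIV_I subset_antisym subset_trans subset_UNIV)
  then have "\<phi> \<in> pompeiu_functions"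
    unfolding pompeiu_functions_def using deriv by (auto simp: real_differentiable_def)
  with \<open>strict_mono \<phi>\<close> show thesis
    by (rule that)
qed

section \<open>Exponentials of exponential sums\<close>

text \<open>Factor out the exponential of largest rate among those with nonzero coefficient. The
  cofactor tends to that coefficient, whose sign decides the direction.\<close>

lemma exp_sum_growth:
  fixes T d :: "'v \<Rightarrow> real"
  assumes "finite V" "inj_on T V" "\<And>v. v \<in> V \<Longrightarrow> 0 < T v" "\<exists>v\<in>V. d v \<noteq> 0"
  obtains v where "v \<in> V" "d v \<noteq> 0"
    "LIM x at_top. (\<Sum>v\<in>V. d v * exp (T v * x)) :> (if 0 < d v then at_top else at_bot)"
proof -
  define W where "W = {v \<in> V. d v \<noteq> 0}"
  have W: "finite W" "W \<noteq> {}" "W \<subseteq> V"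
    using assms(1,4) by (auto simp: W_def)
  have "Max (T ` W) \<in> T ` W"
    using W by (intro Max_in) auto
  then obtain v where v: "v \<in> W" "T v = Max (T ` W)"
    by auto
  have less: "T w < T v" if "w \<in> W - {v}" for w
    using v that inj_onD[OF assms(2), of w v] W(3) Max_ge[of "T ` W" "T w"] W(1)
    by (force simp: order_less_le)
  have "((\<lambda>x. d w * exp ((T w - T v) * x)) \<longlongrightarrow> 0) at_top" if "w \<in> W - {v}" for w
  proof -
    have "LIM x at_top. (T w - T v) * x :> at_bot"
      using less[OF that] by (intro filterlim_tendsto_neg_mult_at_bot[OF tendsto_const] filterlim_ident) simp
    then have "((\<lambda>x. exp ((T w - T v) * x)) \<longlongrightarrow> 0) at_top"
      by (rule filterlim_compose[OF exp_at_bot])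
    then show ?thesis
      by (rule tendsto_mult_right_zero)
  qed
  then have "((\<lambda>x. d v + (\<Sum>w\<in>W - {v}. d w * exp ((T w - T v) * x))) \<longlongrightarrow> d v + (\<Sum>w\<in>W - {v}. 0)) at_top"
    by (intro tendsto_add tendsto_const tendsto_sum) auto
  then have lim: "((\<lambda>x. d v + (\<Sum>w\<in>W - {v}. d w * exp ((T w - T v) * x))) \<longlongrightarrow> d v) at_top"
    by simp
  have eq: "(\<Sum>v\<in>V. d v * exp (T v * x)) =
      (d v + (\<Sum>w\<in>W - {v}. d w * exp ((T w - T v) * x))) * exp (T v * x)" for x
  proof -
    have "(\<Sum>v\<in>V. d v * exp (T v * x)) = (\<Sum>w\<in>W. d w * exp (T w * x))"
      using assms(1) by (intro sum.mono_neutral_right) (auto simp: W_def)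
    also have "\<dots> = (\<Sum>w\<in>W. d w * exp ((T w - T v) * x)) * exp (T v * x)"
      unfolding sum_distrib_right
      by (intro sum.cong) (auto simp: algebra_simps simp flip: exp_add)
    finally show ?thesis
      using W(1) v(1) by (simp add: sum.remove)
  qed
  have "0 < T v"
    using assms(3) v(1) W(3) by auto
  then have "LIM x at_top. T v * x :> at_top"
    by (intro filterlim_tendsto_pos_mult_at_top[OF tendsto_const] filterlim_ident)
  then have top: "LIM x at_top. exp (T v * x) :> at_top"
    by (rule filterlim_compose[OF exp_at_top])
  have "LIM x at_top. (\<Sum>v\<in>V. d v * exp (T v * x)) :> (if 0 < d v then at_top else at_bot)"
    unfolding eq
    using filterlim_tendsto_pos_mult_at_top[OF lim _ top]
      filterlim_tendsto_neg_mult_at_bot[OF lim _ top] v(1) by (auto simp: W_def)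
  then show thesis
    using that v(1) by (auto simp: W_def)
qed

text \<open>Divide by the exponential whose exponent \<open>a m\<close> grows fastest: the
  combination tends to \<open>c m\<close>, while \<open>K * exp (- a m x)\<close> tends to 0,
  contradicting \<open>c m \<noteq> 0\<close>.\<close>

lemma exp_linear_combination_not_constant:
  fixes a :: "'s \<Rightarrow> real \<Rightarrow> real"
  assumes "finite S" "S \<noteq> {}" "\<And>s. s \<in> S \<Longrightarrow> c s \<noteq> 0"
    and at_top: "\<And>s. s \<in> S \<Longrightarrow> LIM x at_top. a s x :> at_top"
    and diff: "\<And>s t. s \<in> S \<Longrightarrow> t \<in> S \<Longrightarrow> s \<noteq> t \<Longrightarrow>
      (LIM x at_top. a s x - a t x :> at_top) \<or> (LIM x at_top. a s x - a t x :> at_bot)"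
  shows "\<not> (\<forall>x. (\<Sum>s\<in>S. c s * exp (a s x)) = K)"
proof
  assume K: "\<forall>x. (\<Sum>s\<in>S. c s * exp (a s x)) = K"
  \<comment> \<open>A maximum for the order by growth, found by induction: a new element is compared
    with the old maximum, and if it wins, transitivity follows by adding two limits.\<close>
  have "\<exists>m\<in>S. \<forall>s\<in>S - {m}. LIM x at_top. a s x - a m x :> at_bot"
    using assms(1,2) diff
  proof (induction S rule: finite_ne_induct)
    case (insert s F)
    then obtain m where m: "m \<in> F" "\<And>t. t \<in> F - {m} \<Longrightarrow> LIM x at_top. a t x - a m x :> at_bot"
      by auto
    have "s \<noteq> m"
      using insert.hyps m(1) by auto
    then consider "LIM x at_top. a s x - a m x :> at_bot" | "LIM x at_top. a s x - a m x :> at_top"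
      using insert.prems[of s m] m(1) by auto
    then show ?case
    proof cases
      case 1
      then show ?thesis using m by blast
    next
      case 2
      then have *: "LIM x at_top. a m x - a s x :> at_bot"
        by (simp add: filterlim_uminus_at_top)
      have "LIM x at_top. a t x - a s x :> at_bot" if "t \<in> F" for t
      proof (cases "t = m")
        case False
        then have "LIM x at_top. - (a t x - a m x) + - (a m x - a s x) :> at_top"
          using m(2)[of t] that * by (intro filterlim_at_top_add_at_top) (auto simp: filterlim_uminus_at_bot)
        then show ?thesis
          by (simp add: filterlim_uminus_at_bot)
      qed (use * in simp)
      then show ?thesis by auto
    qed
  qed auto
  then obtain m where m: "m \<in> S" "\<And>s. s \<in> S - {m} \<Longrightarrow> LIM x at_top. a s x - a m x :> at_bot"
    by auto
  have "((\<lambda>x. c s * exp (a s x - a m x)) \<longlongrightarrow> 0) at_top" if "s \<in> S - {m}" for s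
    using filterlim_compose[OF exp_at_bot m(2)[OF that]] by (rule tendsto_mult_right_zero)
  then have "((\<lambda>x. c m + (\<Sum>s\<in>S - {m}. c s * exp (a s x - a m x))) \<longlongrightarrow> c m + (\<Sum>s\<in>S - {m}. 0)) at_top"
    by (intro tendsto_add tendsto_const tendsto_sum) auto
  moreover have "c m + (\<Sum>s\<in>S - {m}. c s * exp (a s x - a m x)) = K * exp (- a m x)" for x
  proof -
    have "K * exp (- a m x) = (\<Sum>s\<in>S. c s * exp (a s x - a m x))"
      unfolding K[rule_format, symmetric, of x] sum_distrib_right
      by (intro sum.cong) (auto simp: exp_diff exp_minus divide_inverse)
    then show ?thesis
      using assms(1) m(1) by (simp add: sum.remove)
  qed
  ultimately have "((\<lambda>x. K * exp (- a m x)) \<longlongrightarrow> c m) at_top"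
    by simp
  moreover have "((\<lambda>x. K * exp (- a m x)) \<longlongrightarrow> 0) at_top"
  proof -
    have "LIM x at_top. - a m x :> at_bot"
      using at_top[OF m(1)] by (simp add: filterlim_uminus_at_top)
    then show ?thesis
      by (intro tendsto_mult_right_zero filterlim_compose[OF exp_at_bot])
  qed
  ultimately have "c m = 0"
    by (rule tendsto_unique[rotated]) simp
  then show False
    using assms(3) m(1) by blast
qed

text \<open>Identity theorem: \<open>F - K\<close> vanishes on a set that accumulates at
  \<open>a\<close>.\<close>

lemma entire_constant_if_constant_on_real_interval:
  fixes H :: "real \<Rightarrow> real"
  assumes F: "F holomorphic_on UNIV" "\<And>x. F (complex_of_real x) = complex_of_real (H x)"
    and ab: "a < b" "\<And>x. x \<in> {a..b} \<Longrightarrow> H x = K"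
  shows "H x = K"
proof -
  have "a islimpt {a..b}"
    using ab(1) by (simp add: islimpt_Icc)
  then have limpt: "complex_of_real a islimpt complex_of_real ` {a..b}"
    by (intro islimpt_isCont_image) (auto simp: eventually_at_filter)
  have hol: "(\<lambda>z. F z - of_real K) holomorphic_on UNIV"
    using F(1) by (intro holomorphic_intros)
  have zero: "F z - of_real K = 0" if "z \<in> complex_of_real ` {a..b}" for z
    using that by (force simp: F(2) ab(2))
  have "F (of_real x) - of_real K = 0"
    by (rule analytic_continuation[OF hol open_UNIV connected_UNIV subset_UNIV UNIV_I limpt zero UNIV_I])
  then show ?thesis
    by (simp add: F(2))
qed

text \<open>The argument \<open>p\<close> has the shape of a monomial: evaluated at the functions
  \<open>exp (exp (T v * x))\<close>, that monomial equals \<open>exp (exp_form T p x)\<close>.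
  Multiplying monomials thus adds their forms.\<close>

definition exp_form :: "('v \<Rightarrow> real) \<Rightarrow> ('v \<Rightarrow>\<^sub>0 nat) \<Rightarrow> real \<Rightarrow> real" where
  "exp_form T p x = (\<Sum>v\<in>Poly_Mapping.keys p. real (Poly_Mapping.lookup p v) * exp (T v * x))"

lemma exp_form_superset:
  assumes "finite V" "Poly_Mapping.keys p \<subseteq> V"
  shows "exp_form T p x = (\<Sum>v\<in>V. real (Poly_Mapping.lookup p v) * exp (T v * x))"
  unfolding exp_form_def using assms
  by (intro sum.mono_neutral_left) (auto simp: in_keys_iff)

lemma exp_form_add: "exp_form T (p + q) x = exp_form T p x + exp_form T q x"
proof -
  let ?V = "Poly_Mapping.keys p \<union> Poly_Mapping.keys q"
  have "exp_form T r x = (\<Sum>v\<in>?V. real (Poly_Mapping.lookup r v) * exp (T v * x))"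
    if "r \<in> {p, q, p + q}" for r
    using that Poly_Mapping.keys_add[of p q] by (intro exp_form_superset) auto
  then show ?thesis
    by (simp add: Poly_Mapping.lookup_add distrib_right sum.distrib)
qed

lemma exp_form_single: "exp_form T (Poly_Mapping.single v (Suc 0)) x = exp (T v * x)"
  by (simp add: exp_form_def)

lemma exp_form_at_top:
  assumes "inj_on T (Poly_Mapping.keys p)" "\<And>v. v \<in> Poly_Mapping.keys p \<Longrightarrow> 0 < T v" "p \<noteq> 0"
  shows "LIM x at_top. exp_form T p x :> at_top"
proof -
  have "\<exists>v\<in>Poly_Mapping.keys p. real (Poly_Mapping.lookup p v) \<noteq> 0"
    using assms(3) keys_eq_empty[of p] by (simp add: in_keys_iff set_eq_iff del: keys_eq_empty)
  then obtain v where "real (Poly_Mapping.lookup p v) \<noteq> 0"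
    "LIM x at_top. exp_form T p x :> (if 0 < real (Poly_Mapping.lookup p v) then at_top else at_bot)"
    unfolding exp_form_def
    using exp_sum_growth[of "Poly_Mapping.keys p" T "\<lambda>v. real (Poly_Mapping.lookup p v)"] assms(1,2)
    by auto
  then show ?thesis by simp
qed

lemma exp_form_diff_growth:
  assumes "inj_on T (Poly_Mapping.keys p \<union> Poly_Mapping.keys q)"
    "\<And>v. v \<in> Poly_Mapping.keys p \<union> Poly_Mapping.keys q \<Longrightarrow> 0 < T v" "p \<noteq> q"
  shows "(LIM x at_top. exp_form T p x - exp_form T q x :> at_top) \<or>
    (LIM x at_top. exp_form T p x - exp_form T q x :> at_bot)"
proof -
  let ?V = "Poly_Mapping.keys p \<union> Poly_Mapping.keys q"
  let ?d = "\<lambda>v. real (Poly_Mapping.lookup p v) - real (Poly_Mapping.lookup q v)"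
  have "exp_form T p x - exp_form T q x = (\<Sum>v\<in>?V. ?d v * exp (T v * x))" for x
    by (simp add: exp_form_superset[of ?V] left_diff_distrib sum_subtractf)
  moreover obtain v where "Poly_Mapping.lookup p v \<noteq> Poly_Mapping.lookup q v"
    using poly_mapping_eqI[of p q] assms(3) by auto
  then have "\<exists>v\<in>?V. ?d v \<noteq> 0"
    by (intro bexI[of _ v]) (auto simp: in_keys_iff)
  then obtain v where "LIM x at_top. (\<Sum>v\<in>?V. ?d v * exp (T v * x)) :> (if 0 < ?d v then at_top else at_bot)"
    using exp_sum_growth[of ?V T ?d] assms(1,2) by auto
  ultimately show ?thesis
    by (auto split: if_splits)
qed

text \<open>Replacing \<open>x\<close> by a complex variable gives an entire function, so constancy
  on an interval spreads to the line, where growth rules it out. Excluding \<open>p = 0\<close>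
  excludes a constant summand.\<close>

lemma exp_exp_form_not_constant_on:
  assumes S: "finite S" "S \<noteq> {}" "0 \<notin> S" "\<And>p. p \<in> S \<Longrightarrow> c p \<noteq> 0"
    and T: "inj_on T (\<Union>p\<in>S. Poly_Mapping.keys p)" "\<And>v. 0 < T v"
    and ab: "a < b" "\<And>x. x \<in> {a..b} \<Longrightarrow> (\<Sum>p\<in>S. c p * exp (exp_form T p x)) = K"
  shows False
proof -
  let ?F = "\<lambda>z. \<Sum>p\<in>S. of_real (c p) *
    exp (\<Sum>v\<in>Poly_Mapping.keys p. of_nat (Poly_Mapping.lookup p v) * exp (of_real (T v) * z))"
  have "\<forall>x. (\<Sum>p\<in>S. c p * exp (exp_form T p x)) = K"
  proof (intro allI, rule entire_constant_if_constant_on_real_interval[OF _ _ ab])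
    show "?F holomorphic_on UNIV"
      by (intro holomorphic_intros)
    show "?F (complex_of_real x) = complex_of_real (\<Sum>p\<in>S. c p * exp (exp_form T p x))" for x
      by (simp add: exp_form_def flip: exp_of_real)
  qed
  moreover have "\<not> (\<forall>x. (\<Sum>p\<in>S. c p * exp (exp_form T p x)) = K)"
  proof (rule exp_linear_combination_not_constant[OF S(1,2,4)])
    show "LIM x at_top. exp_form T p x :> at_top" if "p \<in> S" for p
      using that S(3) T by (intro exp_form_at_top) (auto intro: inj_on_subset[OF T(1)])
    show "(LIM x at_top. exp_form T p x - exp_form T q x :> at_top) \<or>
        (LIM x at_top. exp_form T p x - exp_form T q x :> at_bot)"
      if "p \<in> S" "q \<in> S" "p \<noteq> q" for p q
      using that T by (intro exp_form_diff_growth) (auto intro: inj_on_subset[OF T(1)])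
  qed
  ultimately show False by contradiction
qed

text \<open>By the intermediate value theorem \<open>\<phi>\<close> maps \<open>{a..b}\<close> onto
  \<open>{\<phi> a..\<phi> b}\<close>, so constancy passes to the outer function.\<close>

lemma exp_exp_form_compose_not_constant_on:
  fixes \<phi> :: "real \<Rightarrow> real"
  assumes S: "finite S" "S \<noteq> {}" "0 \<notin> S" "\<And>p. p \<in> S \<Longrightarrow> c p \<noteq> 0"
    and T: "inj_on T (\<Union>p\<in>S. Poly_Mapping.keys p)" "\<And>v. 0 < T v"
    and \<phi>: "strict_mono \<phi>" "continuous_on UNIV \<phi>"
    and ab: "a < b" "\<And>x. x \<in> {a..b} \<Longrightarrow> (\<Sum>p\<in>S. c p * exp (exp_form T p (\<phi> x))) = K"
  shows False
proof (rule exp_exp_form_not_constant_on[OF S T])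
  show "\<phi> a < \<phi> b"
    using \<phi>(1) ab(1) by (simp add: strict_mono_less)
  fix y assume "y \<in> {\<phi> a..\<phi> b}"
  moreover have "continuous_on {a..b} \<phi>"
    using \<phi>(2) by (rule continuous_on_subset) simp
  ultimately obtain x where "a \<le> x" "x \<le> b" "\<phi> x = y"
    using IVT'[of \<phi> a y b] ab(1) by auto
  then show "(\<Sum>p\<in>S. c p * exp (exp_form T p y)) = K"
    using ab(2)[of x] by simp
qed

section \<open>The algebra of double exponentials of a Pompeiu function\<close>

text \<open>The positive rate is written as \<open>exp s\<close> so that the generators are indexed
  by all of the real line.\<close>

definition exp_exp :: "(real \<Rightarrow> real) \<Rightarrow> real \<Rightarrow> real \<Rightarrow> real" where
  "exp_exp \<phi> s x = exp (exp (exp s * \<phi> x))"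

text \<open>A normal form for the generated algebra, built term by term to allow induction. The
  condition \<open>p \<noteq> 0\<close> reflects the absence of constant terms.\<close>

inductive_set exp_exp_algebra :: "(real \<Rightarrow> real) \<Rightarrow> (real \<Rightarrow> real) set" for \<phi> where
  zero: "(\<lambda>_. 0) \<in> exp_exp_algebra \<phi>"
| add_term: "p \<noteq> 0 \<Longrightarrow> f \<in> exp_exp_algebra \<phi> \<Longrightarrow>
    (\<lambda>x. c * exp (exp_form exp p (\<phi> x)) + f x) \<in> exp_exp_algebra \<phi>"

lemma exp_exp_algebra_add:
  assumes "f \<in> exp_exp_algebra \<phi>" "g \<in> exp_exp_algebra \<phi>"
  shows "(\<lambda>x. f x + g x) \<in> exp_exp_algebra \<phi>"
  using assms
proof (induction f rule: exp_exp_algebra.induct)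
  case (add_term p f c)
  then show ?case
    using exp_exp_algebra.add_term[of p "\<lambda>x. f x + g x" \<phi> c] by (simp add: add.assoc)
qed simp

lemma exp_exp_algebra_mult_term:
  assumes "p \<noteq> 0" "g \<in> exp_exp_algebra \<phi>"
  shows "(\<lambda>x. c * exp (exp_form exp p (\<phi> x)) * g x) \<in> exp_exp_algebra \<phi>"
  using assms(2)
proof (induction g rule: exp_exp_algebra.induct)
  case zero
  then show ?case by (simp add: exp_exp_algebra.zero)
next
  case (add_term q g d)
  \<comment> \<open>Exponents are natural numbers and cannot cancel.\<close>
  have "p + q \<noteq> 0"
  proof
    assume "p + q = 0"
    then have "Poly_Mapping.lookup p v + Poly_Mapping.lookup q v = 0" for v
      by (simp flip: Poly_Mapping.lookup_add)
    then have "p = 0"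
      by (intro poly_mapping_eqI) simp
    with assms(1) show False by contradiction
  qed
  from exp_exp_algebra.add_term[OF this add_term.IH, of "c * d"] show ?case
    by (simp add: exp_form_add exp_add algebra_simps)
qed

lemma exp_exp_algebra_mult:
  assumes "f \<in> exp_exp_algebra \<phi>" "g \<in> exp_exp_algebra \<phi>"
  shows "(\<lambda>x. f x * g x) \<in> exp_exp_algebra \<phi>"
  using assms
proof (induction f rule: exp_exp_algebra.induct)
  case (add_term p f c)
  then show ?case
    using exp_exp_algebra_add[OF exp_exp_algebra_mult_term] by (simp add: distrib_right)
qed (simp add: exp_exp_algebra.zero)

lemma exp_exp_algebra_scale:
  assumes "f \<in> exp_exp_algebra \<phi>"
  shows "(\<lambda>x. c * f x) \<in> exp_exp_algebra \<phi>"
  using assms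
proof (induction f rule: exp_exp_algebra.induct)
  case (add_term p f d)
  from exp_exp_algebra.add_term[OF add_term.hyps(1) add_term.IH, of "c * d"] show ?case
    by (simp add: algebra_simps)
qed (simp add: exp_exp_algebra.zero)

lemma subalg_hull_subset_exp_exp_algebra:
  "subalg hull range (exp_exp \<phi>) \<subseteq> exp_exp_algebra \<phi>"
proof (rule hull_minimal)
  show "subalg (exp_exp_algebra \<phi>)"
    unfolding subalg_def
    using exp_exp_algebra.zero exp_exp_algebra_add exp_exp_algebra_mult exp_exp_algebra_scale by blast
  have "exp_exp \<phi> s \<in> exp_exp_algebra \<phi>" for s
  proof -
    have "Poly_Mapping.single s (Suc 0) \<noteq> 0"
      by (metis lookup_single_eq lookup_zero nat.distinct(1))
    from exp_exp_algebra.add_term[OF this exp_exp_algebra.zero, of 1 \<phi>] show ?thesis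
      by (simp add: exp_form_single exp_exp_def[abs_def])
  qed
  then show "range (exp_exp \<phi>) \<subseteq> exp_exp_algebra \<phi>" by blast
qed

text \<open>The inductive construction may repeat an exponent \<open>p\<close>; like terms are
  collected and zero coefficients discarded.\<close>

lemma exp_exp_algebra_representation:
  assumes "f \<in> exp_exp_algebra \<phi>"
  obtains S c where "finite S" "0 \<notin> S" "\<And>p. p \<in> S \<Longrightarrow> c p \<noteq> 0"
    "f = (\<lambda>x. \<Sum>p\<in>S. c p * exp (exp_form exp p (\<phi> x)))"
proof -
  have "\<exists>S c. finite S \<and> 0 \<notin> S \<and> f = (\<lambda>x. \<Sum>p\<in>S. c p * exp (exp_form exp p (\<phi> x)))"
    using assms
  proof (induction f rule: exp_exp_algebra.induct)
    case zero
    show ?case by (rule exI[of _ "{}"]) simp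
  next
    case (add_term p f d)
    then obtain S c where S: "finite S" "0 \<notin> S"
      and f: "f = (\<lambda>x. \<Sum>p\<in>S. c p * exp (exp_form exp p (\<phi> x)))" by auto
    \<comment> \<open>Outside \<open>S\<close> the value \<open>c p\<close> is arbitrary, so the old
      coefficient is read as 0 there.\<close>
    let ?c = "c(p := d + (if p \<in> S then c p else 0))"
    have "d * exp (exp_form exp p (\<phi> x)) + f x
        = (\<Sum>p\<in>insert p S. ?c p * exp (exp_form exp p (\<phi> x)))" for x
    proof -
      have "(\<Sum>q\<in>insert p S. ?c q * exp (exp_form exp q (\<phi> x)))
          = ?c p * exp (exp_form exp p (\<phi> x)) + (\<Sum>q\<in>S - {p}. c q * exp (exp_form exp q (\<phi> x)))"
        using S(1) by (simp add: sum.insert_remove)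
      then show ?thesis
        using S(1) by (cases "p \<in> S") (simp_all add: f sum.remove[of S p] distrib_right)
    qed
    then show ?case
      using S add_term.hyps(1) by (intro exI[of _ "insert p S"] exI[of _ ?c]) auto
  qed
  then obtain S c where S: "finite S" "0 \<notin> S"
    and f: "f = (\<lambda>x. \<Sum>p\<in>S. c p * exp (exp_form exp p (\<phi> x)))" by auto
  show thesis
  proof (rule that)
    show "f = (\<lambda>x. \<Sum>p\<in>{p \<in> S. c p \<noteq> 0}. c p * exp (exp_form exp p (\<phi> x)))"
      unfolding f using S(1) by (intro ext sum.mono_neutral_right) auto
  qed (use S in auto)
qed

lemma exp_exp_algebra_nowhere_constant:
  assumes "f \<in> exp_exp_algebra \<phi>" "f \<noteq> (\<lambda>_. 0)" "strict_mono \<phi>" "continuous_on UNIV \<phi>"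
  shows "nowhere_constant f"
  unfolding nowhere_constant_def
proof (intro allI impI notI)
  fix I :: "real set"
  assume I: "is_interval I \<and> (\<exists>a\<in>I. \<exists>b\<in>I. a < b)" and "f constant_on I"
  then obtain a b K where ab: "a \<in> I" "b \<in> I" "a < b" and K: "\<And>x. x \<in> I \<Longrightarrow> f x = K"
    by (auto simp: constant_on_def)
  obtain S c where S: "finite S" "0 \<notin> S" "\<And>p. p \<in> S \<Longrightarrow> c p \<noteq> 0"
    and f: "f = (\<lambda>x. \<Sum>p\<in>S. c p * exp (exp_form exp p (\<phi> x)))"
    using exp_exp_algebra_representation[OF assms(1)] by blast
  have "S \<noteq> {}"
  proof
    assume "S = {}"
    then have "f = (\<lambda>_. 0)" unfolding f by simp
    with assms(2) show False by contradiction
  qed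
  have "{a..b} \<subseteq> I"
    using I ab(1,2) mem_is_interval_1_I[of I a b] by auto
  then have const: "(\<Sum>p\<in>S. c p * exp (exp_form exp p (\<phi> x))) = K" if "x \<in> {a..b}" for x
    using K[of x] that unfolding f by auto
  show False
    by (rule exp_exp_form_compose_not_constant_on[OF S(1) \<open>S \<noteq> {}\<close> S(2,3) _ _ assms(3,4) ab(3) const])
       (auto simp: inj_on_def)
qed

text \<open>By the chain rule the derivative of \<open>\<phi>\<close> is a factor, so
  \<open>f\<close> inherits its critical points.\<close>

lemma exp_exp_algebra_has_derivative:
  assumes "f \<in> exp_exp_algebra \<phi>" "(\<phi> has_real_derivative d) (at x)"
  shows "\<exists>e. (f has_real_derivative e * d) (at x)"
  using assms(1)
proof (induction f rule: exp_exp_algebra.induct)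
  case zero
  show ?case by (rule exI[of _ 0]) simp
next
  case (add_term p f c)
  then obtain e where e: "(f has_real_derivative e * d) (at x)" by blast
  let ?e' = "\<Sum>v\<in>Poly_Mapping.keys p. real (Poly_Mapping.lookup p v) * (exp (exp v * \<phi> x) * exp v)"
  have "((\<lambda>x. exp_form exp p (\<phi> x)) has_real_derivative ?e' * d) (at x)"
    unfolding exp_form_def sum_distrib_right
    by (auto intro!: derivative_eq_intros assms(2) sum.cong)
  then have "((\<lambda>x. c * exp (exp_form exp p (\<phi> x)) + f x) has_real_derivative
      (c * exp (exp_form exp p (\<phi> x)) * ?e' + e) * d) (at x)"
    using e by (auto intro!: derivative_eq_intros simp: algebra_simps)
  then show ?case by blast
qed

lemma exp_exp_algebra_pompeiu:
  assumes "f \<in> exp_exp_algebra \<phi>" "\<phi> \<in> pompeiu_functions"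
  shows "f \<in> pompeiu_functions"
proof -
  have \<phi>: "(\<phi> has_real_derivative deriv \<phi> x) (at x)" for x
    using assms(2) DERIV_deriv_iff_real_differentiable by (auto simp: pompeiu_functions_def)
  have f: "\<exists>e. (f has_real_derivative e * deriv \<phi> x) (at x)" for x
    using exp_exp_algebra_has_derivative[OF assms(1) \<phi>] .
  have "{x. deriv \<phi> x = 0} \<subseteq> {x. deriv f x = 0}"
  proof clarsimp
    fix x assume "deriv \<phi> x = 0"
    then show "deriv f x = 0"
      using f[of x] DERIV_imp_deriv by fastforce
  qed
  from closure_mono[OF this] have "closure {x. deriv f x = 0} = UNIV"
    using assms(2) by (auto simp: pompeiu_functions_def)
  then show ?thesis
    using f by (auto simp: pompeiu_functions_def real_differentiable_def)
qed

lemma pompeiu_functions_continuous: "pompeiu_functions \<subseteq> cont_funs"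
  by (auto simp: pompeiu_functions_def cont_funs_def
      intro!: continuous_at_imp_continuous_on differentiable_imp_continuous_within)

lemma subalg_hull: "subalg (subalg hull B)"
  by (rule hull_in) (simp add: subalg_def)

lemma inj_exp_exp:
  assumes "\<phi> x \<noteq> 0"
  shows "inj (exp_exp \<phi>)"
proof (rule injI)
  fix s t assume "exp_exp \<phi> s = exp_exp \<phi> t"
  then have "exp_exp \<phi> s x = exp_exp \<phi> t x" by simp
  then show "s = t"
    using assms by (simp add: exp_exp_def)
qed

lemma mpoly_apply_exp_exp:
  "mpoly_apply P (\<lambda>i. exp_exp \<phi> (s i)) x =
    (\<Sum>m\<in>Poly_Mapping.keys P. Poly_Mapping.lookup P m * exp (exp_form (exp \<circ> s) m (\<phi> x)))"
  unfolding mpoly_apply_def exp_exp_def exp_form_def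
  by (simp add: exp_sum exp_of_nat_mult)

lemma freely_generates_exp_exp:
  assumes "strict_mono \<phi>" "continuous_on UNIV \<phi>"
  shows "freely_generates (range (exp_exp \<phi>)) (subalg hull range (exp_exp \<phi>))"
  unfolding freely_generates_def
proof (intro conjI refl allI impI notI)
  fix N P f
  assume "in_variables N P \<and> P \<noteq> 0 \<and> Poly_Mapping.lookup P 0 = 0 \<and>
    inj_on f {..<N} \<and> f ` {..<N} \<subseteq> range (exp_exp \<phi>)"
  then have P: "in_variables N P" "P \<noteq> 0" "Poly_Mapping.lookup P 0 = 0"
    and f: "inj_on f {..<N}" "f ` {..<N} \<subseteq> range (exp_exp \<phi>)"
    by auto
  assume zero: "mpoly_apply P f = (\<lambda>_. 0)"
  have "\<forall>i\<in>{..<N}. \<exists>s. f i = exp_exp \<phi> s"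
    using f(2) by blast
  then obtain s where s: "\<And>i. i \<in> {..<N} \<Longrightarrow> f i = exp_exp \<phi> (s i)"
    by metis
  have keys: "(\<Union>m\<in>Poly_Mapping.keys P. Poly_Mapping.keys m) \<subseteq> {..<N}"
    using P(1) by (auto simp: in_variables_def)
  \<comment> \<open>Distinct generators have distinct parameters, hence distinct rates
    \<open>exp (s i)\<close>.\<close>
  have "inj_on s {..<N}"
    using f(1) s by (metis inj_on_def)
  then have inj: "inj_on (exp \<circ> s) (\<Union>m\<in>Poly_Mapping.keys P. Poly_Mapping.keys m)"
    using keys by (auto simp: inj_on_def)
  have "mpoly_apply P f x = mpoly_apply P (\<lambda>i. exp_exp \<phi> (s i)) x" for x
    unfolding mpoly_apply_def using s keys by (intro sum.cong arg_cong2[where f = "(*)"] prod.cong) auto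
  then have "(\<Sum>m\<in>Poly_Mapping.keys P. Poly_Mapping.lookup P m * exp (exp_form (exp \<circ> s) m (\<phi> x))) = 0" for x
    using zero by (simp add: mpoly_apply_exp_exp)
  moreover have "Poly_Mapping.keys P \<noteq> {}" "0 \<notin> Poly_Mapping.keys P"
    using P(2,3) by (auto simp: in_keys_iff poly_mapping_eq_iff fun_eq_iff)
  \<comment> \<open>A vanishing combination is in particular constant on
    \<open>{0..1}\<close>.\<close>
  ultimately show False
    using exp_exp_form_compose_not_constant_on[of "Poly_Mapping.keys P" "Poly_Mapping.lookup P" "exp \<circ> s" \<phi> 0 1 0]
      inj assms by (simp add: in_keys_iff)
qed

section \<open>Density\<close>

text \<open>The prefactor \<open>w\<close> keeps the result in the non-unital algebra even if
  \<open>p\<close> has a constant term. It is arbitrary in the induction so that in a product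
  \<open>w * f(u)\<close> can serve as prefactor for \<open>g\<close>.\<close>

lemma subalg_mult_polynomial:
  assumes M: "subalg M" "u \<in> M" and "real_polynomial_function p"
  shows "w \<in> M \<Longrightarrow> (\<lambda>x. w x * p (u x)) \<in> M"
  using assms(3)
proof (induction p arbitrary: w rule: real_polynomial_function.induct)
  case (linear h)
  then obtain c where c: "h = (\<lambda>x. x * c)"
    using real_bounded_linear by blast
  have "(\<lambda>x. c * (w x * u x)) \<in> M"
    using M linear.prems by (simp add: subalg_def)
  then show ?case
    by (simp add: c mult_ac)
next
  case (const c)
  then have "(\<lambda>x. c * w x) \<in> M"
    using M by (simp add: subalg_def)
  then show ?case by (simp add: mult_ac)
next
  case (add f g)
  then show ?case
    using M by (simp add: subalg_def distrib_left)
next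
  case (mult f g)
  then have "(\<lambda>x. (w x * f (u x)) * g (u x)) \<in> M" by blast
  then show ?case by (simp add: mult_ac)
qed

text \<open>To approximate \<open>f\<close> by polynomials without constant term in \<open>u\<close>, approximate \<open>f / u\<close>
  by a polynomial in \<open>u\<close> and multiply by \<open>u\<close>.\<close>

lemma subalg_dense:
  assumes M: "subalg M" "M \<subseteq> cont_funs" "u \<in> M" and u: "inj u" "\<And>x. u x \<noteq> 0"
  shows "ucc_topology closure_of M = topspace ucc_topology"
proof
  show "topspace ucc_topology \<subseteq> ucc_topology closure_of M"
  proof
    fix f assume "f \<in> topspace ucc_topology"
    then have f: "continuous_on UNIV f"
      by (simp add: topspace_ucc_topology cont_funs_def)
    have "\<exists>g\<in>M. g \<in> U" if U: "f \<in> U" "openin ucc_topology U" for U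
    proof -
      obtain K e where K: "compact K" "0 < e" "{g \<in> cont_funs. \<forall>x\<in>K. \<bar>g x - f x\<bar> < e} \<subseteq> U"
        using U unfolding openin_ucc_topology ucc_open_def by blast
      have cu: "continuous_on K u"
        using M(2,3) by (auto simp: cont_funs_def intro: continuous_on_subset)
      \<comment> \<open>Multiplication by \<open>u\<close> enlarges errors on \<open>K\<close> by at
        most the factor \<open>B\<close>; hence the tolerance \<open>e / B\<close> below.\<close>
      obtain B where B: "0 < B" "\<And>x. x \<in> K \<Longrightarrow> \<bar>u x\<bar> \<le> B"
        using compact_imp_bounded[OF compact_continuous_image[OF cu K(1)]]
        unfolding bounded_pos by auto
      define h where "h = (\<lambda>y. f (inv u y) / y)"
      \<comment> \<open>A continuous injection on a compact set has a continuous inverse.\<close>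
      have "continuous_on (u ` K) (inv u)"
        using cu K(1) u(1) by (intro continuous_on_inv) auto
      then have "continuous_on (u ` K) h"
        unfolding h_def using u(2)
        by (intro continuous_intros continuous_on_compose2[OF f]) auto
      then obtain p where p: "real_polynomial_function p" "\<And>y. y \<in> u ` K \<Longrightarrow> \<bar>h y - p y\<bar> < e / B"
        using Stone_Weierstrass_real_polynomial_function[OF compact_continuous_image[OF cu K(1)], of h "e / B"]
          K(2) B(1) by auto
      let ?g = "\<lambda>x. u x * p (u x)"
      have "?g \<in> M"
        using subalg_mult_polynomial[OF M(1,3) p(1) M(3)] .
      moreover have "\<bar>?g x - f x\<bar> < e" if "x \<in> K" for x
      proof -
        have "f x = u x * h (u x)"
          using u by (simp add: h_def)
        then have "\<bar>?g x - f x\<bar> = \<bar>u x\<bar> * \<bar>h (u x) - p (u x)\<bar>"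
          by (metis abs_minus_commute abs_mult right_diff_distrib)
        also have "\<dots> < \<bar>u x\<bar> * (e / B)"
          using p(2) that u(2) by (intro mult_strict_left_mono) auto
        also have "\<dots> \<le> B * (e / B)"
          using B(2)[OF that] B(1) K(2) by (intro mult_right_mono) auto
        finally show ?thesis using B(1) by simp
      qed
      ultimately show ?thesis
        using K(3) M(2) by blast
    qed
    then show "f \<in> ucc_topology closure_of M"
      using \<open>f \<in> topspace ucc_topology\<close> unfolding in_closure_of by blast
  qed
qed (rule closure_of_subset_topspace)

theorem theorem4p4:
  "densely_strongly_continuum_algebrable {f \<in> pompeiu_functions. nowhere_constant f}"
proof -
  obtain \<phi> :: "real \<Rightarrow> real" where \<phi>: "strict_mono \<phi>" "\<phi> \<in> pompeiu_functions"
    by (rule ex_strict_mono_pompeiu)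
  have cont: "continuous_on UNIV \<phi>"
    using \<phi>(2) pompeiu_functions_continuous by (auto simp: cont_funs_def)
  let ?A = "{f \<in> pompeiu_functions. nowhere_constant f}"
  let ?B = "range (exp_exp \<phi>)"
  let ?M = "subalg hull ?B"
  have A: "?A \<subseteq> cont_funs"
    using pompeiu_functions_continuous by auto
  have M_A: "?M - {\<lambda>_. 0} \<subseteq> ?A"
    using subalg_hull_subset_exp_exp_algebra[of \<phi>] exp_exp_algebra_nowhere_constant[OF _ _ \<phi>(1) cont]
      exp_exp_algebra_pompeiu[OF _ \<phi>(2)] by auto
  have M_cont: "?M \<subseteq> cont_funs"
  proof
    fix f assume "f \<in> ?M"
    then show "f \<in> cont_funs"
      using M_A A by (cases "f = (\<lambda>_. 0)") (auto simp: cont_funs_def)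
  qed
  have "\<phi> 0 < \<phi> 1"
    using \<phi>(1) by (simp add: strict_mono_less)
  \<comment> \<open>Injectivity in the parameter needs one point where \<open>\<phi>\<close> is
    nonzero.\<close>
  then have "\<phi> 0 \<noteq> 0 \<or> \<phi> 1 \<noteq> 0"
    by linarith
  then have "inj (exp_exp \<phi>)"
    using inj_exp_exp[of \<phi> 0] inj_exp_exp[of \<phi> 1] by blast
  then have card: "?B \<approx> (UNIV :: real set)"
    by (rule inj_on_image_eqpoll_self)
  have "inj (exp_exp \<phi> 0)"
    using strict_mono_imp_inj_on[OF \<phi>(1)] by (auto simp: inj_def exp_exp_def)
  then have dense: "ucc_topology closure_of ?M = topspace ucc_topology"
    by (rule subalg_dense[OF subalg_hull M_cont hull_inc[OF rangeI]]) (simp add: exp_exp_def)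
  have "?B \<subseteq> cont_funs"
    using hull_subset[of ?B subalg] M_cont by (rule subset_trans)
  then show ?thesis
    unfolding densely_strongly_continuum_algebrable_def
    using A card freely_generates_exp_exp[OF \<phi>(1) cont] M_A dense by blast
qed

end
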